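(* Let $(L,\delta,R)$ be a $\lambda$-weighted Rota-Baxter LieDer pair. If $\mathcal H^2_{\mathrm{RBLieDer}}(L,L)=0$, then any formal $1$-parameter deformation $(\gamma_t,\delta_t,R_t)$ of $(L,\delta,R)$ is equivalent to the trivial one $(\gamma'_t=\gamma,\ \delta'_t=\delta,\ R'_t=R)$, where $\gamma=[\cdot,\cdot]$ is the Lie bracket of $L$.
   Context: Fix a field $\mathbb{K}$ and $\lambda\in\mathbb{K}$. A $\lambda$-weighted Rota-Baxter LieDer pair $(L,\delta,R)$ is a Lie algebra $(L,[\cdot,\cdot])$ over $\mathbb K$, a derivation $\delta$, and a linear map $R:L\to L$ with $[Rx,Ry]=R([Rx,y]+[x,Ry]+\lambda[x,y])$ and $R\circ\delta=\delta\circ R$. Formal deformation. A formal $1$-parameter deformation of $(L,\delta,R)$ is a triple of formal power series $\gamma_t=\sum_{i\ge0}\gamma_it^i$ with $\gamma_i\in\mathrm{Hom}(\wedge^2L,L)$, $\gamma_0=[\cdot,\cdot]$; $\delta_t=\sum_{i\ge0}\delta_it^i$ with $\delta_i\in\mathrm{Hom}(L,L)$, $\delta_0=\delta$; $R_t=\sum_{i\ge0}R_it^i$ with $R_i\in\mathrm{Hom}(L,L)$, $R_0=R$; such that on $L[[t]]$ (extending $\mathbb K[[t]]$-(bi)linearly) $\gamma_t$ is a Lie bracket, $\delta_t$ is a derivation of $\gamma_t$, and $R_t$ is a $\lambda$-weighted Rota-Baxter operator for $\gamma_t$; that is, for all $x,y,z\in L$: $\gamma_t(x,\gamma_t(y,z))+\gamma_t(y,\gamma_t(z,x))+\gamma_t(z,\gamma_t(x,y))=0$,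 $\gamma_t(R_tx,R_ty)=R_t(\gamma_t(R_tx,y)+\gamma_t(x,R_ty)+\lambda\gamma_t(x,y))$, $\delta_t(\gamma_t(x,y))=\gamma_t(\delta_tx,y)+\gamma_t(x,\delta_ty)$. Equivalence. Two formal deformations $(\gamma_t,\delta_t,R_t)$ and $(\gamma'_t,\delta'_t,R'_t)$ are equivalent if there is a formal isomorphism $\varphi_t=\sum_{i\ge0}\varphi_it^i:L[[t]]\to L[[t]]$ ($\mathbb K[[t]]$-linear, $\varphi_i\in\mathrm{Hom}(L,L)$, $\varphi_0=\mathrm{id}_L$) with $\varphi_t(\gamma'_t(x,y))=\gamma_t(\varphi_t(x),\varphi_t(y))$, $\varphi_t\circ\delta'_t=\delta_t\circ\varphi_t$, $\varphi_t\circ R'_t=R_t\circ\varphi_t$. Cohomology with coefficients in the adjoint representation. Put $[x,y]_R=[Rx,y]+[x,Ry]+\lambda[x,y]$ and $\widetilde\rho(x)(y)=[Rx,y]-R[x,y]$. On $C^n=\mathrm{Hom}(\wedge^nL,L)$ define $(\mathrm{d}f)(x_1,\dots,x_{n+1})=\sum_{i}(-1)^{i+n}[x_i,f(x_1,\dots,\hat{x_i},\dots,x_{n+1})]+\sum_{i<j}(-1)^{i+j+n+1}f([x_i,x_j],x_1,\dots,\hat{x_i},\dots,\hat{x_j},\dots,x_{n+1})$; $\mathrm{d}_R$ by the same formula with $[x_i,f(\cdots)]$ replaced by $\widetilde\rho(x_i)f(\cdots)$ and $[x_i,x_j]$ replaced by $[x_i,x_j]_R$; $\partial f=\sum_{i=1}^nf\circ(\mathbf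 1\otimes\cdots\otimes\delta\otimes\cdots\otimes\mathbf 1)-\delta\circ f$ ($\delta$ in the $i$-th place); and $\Phi(f)(x_1,\dots,x_n)=f(Rx_1,\dots,Rx_n)-\sum_{k=0}^{n-1}\lambda^{n-k-1}\sum_{i_1<\cdots<i_k}R\big(f(x_1,\dots,R(x_{i_1}),\dots,R(x_{i_k}),\dots,x_n)\big)$ ($R$ applied exactly to the arguments in positions $i_1,\dots,i_k$). The cochain spaces are $\mathfrak C^0_{\mathrm{RBLieDer}}(L,L)=0$, $\mathfrak C^1_{\mathrm{RBLieDer}}(L,L)=\mathrm{Hom}(L,L)$, $\mathfrak C^n_{\mathrm{RBLieDer}}(L,L)=(C^n\oplus C^{n-1})\oplus C^{n-1}$ for $n\ge2$, with differential $\mathfrak D_{\mathrm{RBLieDer}}(f)=(\mathrm{d}f,-\partial f,-\Phi f)$ for $n=1$ and $\mathfrak D_{\mathrm{RBLieDer}}((f,g),h)=(\mathrm{d}f,\mathrm{d}g+(-1)^n\partial f,-\mathrm{d}_Rh-\Phi f)$ for $n\ge2$. This squares to zero, and $\mathcal H^n_{\mathrm{RBLieDer}}(L,L)$ denotes its $n$-th cohomology group. *)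

theory Defs
  imports
    "HOL-Computational_Algebra.Formal_Power_Series"
    "HOL-Algebra.Elementary_Groups"
    "HOL-Library.Function_Algebras"
    "HOL-Library.Product_Plus"
begin

section \<open>Rota-Baxter LieDer pairs\<close>

definition alternating_bilinear ::
    "('k::field \<Rightarrow> 'l::ab_group_add \<Rightarrow> 'l) \<Rightarrow> ('l \<Rightarrow> 'l \<Rightarrow> 'l) \<Rightarrow> bool" where
  "alternating_bilinear scale g \<longleftrightarrow>
     (\<forall>x. Vector_Spaces.linear scale scale (g x)) \<and>
     (\<forall>y. Vector_Spaces.linear scale scale (\<lambda>x. g x y)) \<and>
     (\<forall>x. g x x = 0)"

text \<open>The vector space \<open>L\<close> is the whole type \<open>'l\<close>, the ground field is the type \<open>'k\<close>.\<close>

locale lie_algebra = vector_space scale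
  for scale :: "'k::field \<Rightarrow> 'l::ab_group_add \<Rightarrow> 'l" (infixr \<open>*s\<close> 75) +
  fixes bracket :: "'l \<Rightarrow> 'l \<Rightarrow> 'l"
  assumes alternating_bilinear_bracket: "alternating_bilinear scale bracket"
    and jacobi:
      "bracket x (bracket y z) + bracket y (bracket z x) + bracket z (bracket x y) = 0"

locale rb_lieder_pair = lie_algebra scale bracket
  for scale :: "'k::field \<Rightarrow> 'l::ab_group_add \<Rightarrow> 'l" (infixr \<open>*s\<close> 75)
    and bracket :: "'l \<Rightarrow> 'l \<Rightarrow> 'l" +
  fixes lam :: 'k
    and \<delta> :: "'l \<Rightarrow> 'l"
    and R :: "'l \<Rightarrow> 'l"
  assumes linear_\<delta>: "Vector_Spaces.linear scale scale \<delta>"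
    and derivation: "\<delta> (bracket x y) = bracket (\<delta> x) y + bracket x (\<delta> y)"
    and linear_R: "Vector_Spaces.linear scale scale R"
    and rota_baxter:
      "bracket (R x) (R y) = R (bracket (R x) y + bracket x (R y) + lam *s bracket x y)"
    and R_\<delta>_commute: "R \<circ> \<delta> = \<delta> \<circ> R"


section \<open>The cochain complex with adjoint coefficients\<close>

text \<open>An element of \<open>C\<^sup>n = Hom(\<And>\<^sup>n L, L)\<close> is a function on argument lists, alternating and
  multilinear on lists of length \<open>n\<close>. It is extended by \<open>0\<close> to lists of any other length, so that
  equality of functions is equality of cochains.\<close>

definition alt_cochains ::
    "('k::field \<Rightarrow> 'l::ab_group_add \<Rightarrow> 'l) \<Rightarrow> nat \<Rightarrow> ('l list \<Rightarrow> 'l) set" where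
  "alt_cochains scale n = {f.
     (\<forall>xs i. length xs = n \<longrightarrow> i < n \<longrightarrow>
        Vector_Spaces.linear scale scale (\<lambda>x. f (xs[i := x]))) \<and>
     (\<forall>xs i j. length xs = n \<longrightarrow> i < j \<longrightarrow> j < n \<longrightarrow> xs ! i = xs ! j \<longrightarrow> f xs = 0) \<and>
     (\<forall>xs. length xs \<noteq> n \<longrightarrow> f xs = 0)}"

text \<open>The Chevalley--Eilenberg formula for a bracket \<open>br\<close> and an action \<open>rho\<close>. Lists are indexed
  from \<open>0\<close>, so the positions of the usual formula are \<open>i + 1\<close> and \<open>j + 1\<close>.\<close>

definition ce_differential ::
    "('k::field \<Rightarrow> 'l::ab_group_add \<Rightarrow> 'l) \<Rightarrow> ('l \<Rightarrow> 'l \<Rightarrow> 'l) \<Rightarrow> ('l \<Rightarrow> 'l \<Rightarrow> 'l) \<Rightarrow>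
     nat \<Rightarrow> ('l list \<Rightarrow> 'l) \<Rightarrow> 'l list \<Rightarrow> 'l" where
  "ce_differential scale br rho n f xs =
     (if length xs = n + 1 then
        (\<Sum>i<n+1. scale ((-1) ^ ((i+1) + n)) (rho (xs ! i) (f (nths xs (- {i}))))) +
        (\<Sum>(i,j) | i < j \<and> j < n+1.
           scale ((-1) ^ ((i+1) + (j+1) + n + 1))
             (f (br (xs ! i) (xs ! j) # nths xs (- {i,j}))))
      else 0)"

type_synonym 'l rbld_cochain = "(('l list \<Rightarrow> 'l) \<times> ('l list \<Rightarrow> 'l)) \<times> ('l list \<Rightarrow> 'l)"

context rb_lieder_pair
begin

definition bracket_R :: "'l \<Rightarrow> 'l \<Rightarrow> 'l" where
  "bracket_R x y = bracket (R x) y + bracket x (R y) + lam *s bracket x y"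

definition rho_R :: "'l \<Rightarrow> 'l \<Rightarrow> 'l" where
  "rho_R x y = bracket (R x) y - R (bracket x y)"

definition d :: "nat \<Rightarrow> ('l list \<Rightarrow> 'l) \<Rightarrow> 'l list \<Rightarrow> 'l" where
  "d = ce_differential scale bracket bracket"

definition d_R :: "nat \<Rightarrow> ('l list \<Rightarrow> 'l) \<Rightarrow> 'l list \<Rightarrow> 'l" where
  "d_R = ce_differential scale bracket_R rho_R"

definition partial_\<delta> :: "nat \<Rightarrow> ('l list \<Rightarrow> 'l) \<Rightarrow> 'l list \<Rightarrow> 'l" where
  "partial_\<delta> n f xs =
     (if length xs = n then (\<Sum>i<n. f (xs[i := \<delta> (xs ! i)])) - \<delta> (f xs) else 0)"

definition Phi :: "nat \<Rightarrow> ('l list \<Rightarrow> 'l) \<Rightarrow> 'l list \<Rightarrow> 'l" where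
  "Phi n f xs =
     (if length xs = n then
        f (map R xs) -
        (\<Sum>k<n. lam ^ (n - k - 1) *s
           (\<Sum>I | I \<subseteq> {..<n} \<and> card I = k.
              R (f (map (\<lambda>i. if i \<in> I then R (xs ! i) else xs ! i) [0..<n]))))
      else 0)"

text \<open>Cochains of all degrees live in one type of triples: degree \<open>0\<close> is \<open>0\<close>, and the cochain
  \<open>f \<in> Hom(L, L)\<close> of degree \<open>1\<close> is the triple \<open>((f, 0), 0)\<close>.\<close>

definition rbld_cochains :: "nat \<Rightarrow> 'l rbld_cochain set" where
  "rbld_cochains n =
     (if n = 0 then {0}
      else if n = 1 then {((f, 0), 0) | f. f \<in> alt_cochains scale 1}
      else (alt_cochains scale n \<times> alt_cochains scale (n - 1)) \<times> alt_cochains scale (n - 1))"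

fun rbld_differential :: "nat \<Rightarrow> 'l rbld_cochain \<Rightarrow> 'l rbld_cochain" where
  "rbld_differential n ((f, g), h) =
     (if n = 0 then 0
      else if n = 1 then ((d 1 f, - partial_\<delta> 1 f), - Phi 1 f)
      else ((d n f, d (n - 1) g + (\<lambda>xs. (-1) ^ n *s partial_\<delta> n f xs)),
            - d_R (n - 1) h - Phi n f))"

definition rbld_cocycles :: "nat \<Rightarrow> 'l rbld_cochain set" where
  "rbld_cocycles n = {c \<in> rbld_cochains n. rbld_differential n c = 0}"

definition rbld_coboundaries :: "nat \<Rightarrow> 'l rbld_cochain set" where
  "rbld_coboundaries n =
     (if n = 0 then {0} else rbld_differential (n - 1) ` rbld_cochains (n - 1))"

definition rbld_cohomology :: "nat \<Rightarrow> 'l rbld_cochain set monoid" where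
  "rbld_cohomology n =
     \<lparr>carrier = rbld_cocycles n, mult = (+), one = 0\<rparr> Mod rbld_coboundaries n"

end


section \<open>Formal deformations\<close>

text \<open>Elements of \<open>L[[t]]\<close> are of type \<open>'l fps\<close>, with \<open>L\<close> embedded by \<^const>\<open>fps_const\<close>. A series
  of maps \<open>\<Sum>\<^sub>i F\<^sub>i t\<^sup>i\<close> is its sequence of coefficients; the following are the induced
  \<open>K[[t]]\<close>-linear and \<open>K[[t]]\<close>-bilinear maps on \<open>L[[t]]\<close>.\<close>

definition ext_linear :: "(nat \<Rightarrow> 'l \<Rightarrow> 'l) \<Rightarrow> 'l::ab_group_add fps \<Rightarrow> 'l fps" where
  "ext_linear F X = Abs_fps (\<lambda>n. \<Sum>i\<le>n. F i (fps_nth X (n - i)))"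

definition ext_bilinear ::
    "(nat \<Rightarrow> 'l \<Rightarrow> 'l \<Rightarrow> 'l) \<Rightarrow> 'l::ab_group_add fps \<Rightarrow> 'l fps \<Rightarrow> 'l fps" where
  "ext_bilinear G X Y =
     Abs_fps (\<lambda>n. \<Sum>i\<le>n. \<Sum>j\<le>n - i. G i (fps_nth X j) (fps_nth Y (n - i - j)))"

definition fps_scale ::
    "('k \<Rightarrow> 'l \<Rightarrow> 'l) \<Rightarrow> 'k::field \<Rightarrow> 'l::ab_group_add fps \<Rightarrow> 'l fps" where
  "fps_scale scale c X = Abs_fps (\<lambda>n. scale c (fps_nth X n))"

definition const_series :: "'a::zero \<Rightarrow> nat \<Rightarrow> 'a" where
  "const_series a = (\<lambda>i. if i = 0 then a else 0)"

definition (in rb_lieder_pair) formal_deformation ::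
    "(nat \<Rightarrow> 'l \<Rightarrow> 'l \<Rightarrow> 'l) \<Rightarrow> (nat \<Rightarrow> 'l \<Rightarrow> 'l) \<Rightarrow> (nat \<Rightarrow> 'l \<Rightarrow> 'l) \<Rightarrow> bool" where
  "formal_deformation \<gamma>t \<delta>t Rt \<longleftrightarrow>
     (\<forall>i. alternating_bilinear scale (\<gamma>t i)) \<and> \<gamma>t 0 = bracket \<and>
     (\<forall>i. Vector_Spaces.linear scale scale (\<delta>t i)) \<and> \<delta>t 0 = \<delta> \<and>
     (\<forall>i. Vector_Spaces.linear scale scale (Rt i)) \<and> Rt 0 = R \<and>
     (\<forall>a b c. let x = fps_const a; y = fps_const b; z = fps_const c;
         \<gamma> = ext_bilinear \<gamma>t; D = ext_linear \<delta>t; P = ext_linear Rt in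
       \<gamma> x (\<gamma> y z) + \<gamma> y (\<gamma> z x) + \<gamma> z (\<gamma> x y) = 0 \<and>
       \<gamma> (P x) (P y) = P (\<gamma> (P x) y + \<gamma> x (P y) + fps_scale scale lam (\<gamma> x y)) \<and>
       D (\<gamma> x y) = \<gamma> (D x) y + \<gamma> x (D y))"

text \<open>The condition \<open>\<phi> 0 = id\<close> already makes \<open>ext_linear \<phi>\<close> bijective.\<close>

definition equivalent_deformations ::
    "('k::field \<Rightarrow> 'l::ab_group_add \<Rightarrow> 'l) \<Rightarrow>
     (nat \<Rightarrow> 'l \<Rightarrow> 'l \<Rightarrow> 'l) \<times> (nat \<Rightarrow> 'l \<Rightarrow> 'l) \<times> (nat \<Rightarrow> 'l \<Rightarrow> 'l) \<Rightarrow>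
     (nat \<Rightarrow> 'l \<Rightarrow> 'l \<Rightarrow> 'l) \<times> (nat \<Rightarrow> 'l \<Rightarrow> 'l) \<times> (nat \<Rightarrow> 'l \<Rightarrow> 'l) \<Rightarrow> bool" where
  "equivalent_deformations scale = (\<lambda>(\<gamma>t, \<delta>t, Rt) (\<gamma>t', \<delta>t', Rt').
     (\<exists>\<phi>. (\<forall>i. Vector_Spaces.linear scale scale (\<phi> i)) \<and> \<phi> 0 = id \<and>
       (\<forall>X Y. ext_linear \<phi> (ext_bilinear \<gamma>t' X Y) =
              ext_bilinear \<gamma>t (ext_linear \<phi> X) (ext_linear \<phi> Y)) \<and>
       ext_linear \<phi> \<circ> ext_linear \<delta>t' = ext_linear \<delta>t \<circ> ext_linear \<phi> \<and>
       ext_linear \<phi> \<circ> ext_linear Rt' = ext_linear Rt \<circ> ext_linear \<phi>))"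

end

(* The formal isomorphism phi is constructed coefficient by coefficient. If phi_0, ..., phi_(n-1)
   intertwine the trivial structure with the deformed one modulo t^n, let psi be their sum. Then
   gamma_t(psi x, psi y) = psi [x,y] + t^n E(x,y), and similarly delta_t psi = psi delta + t^n G
   and R_t psi = psi R + t^n H. Substituting this in the identities of the deformation, extended
   to L[[t]], shows that the constant terms of (E, G, H) form a 2-cocycle; if it is the coboundary
   of p, then phi_n = -p removes the error of order n. No inverse of psi is needed.
   Operators on L[[t]] that are additive and commute with multiplication by t are determined by
   their values on L, which is how identities pass from L to L[[t]]. *)
theory Submission
  imports Defs
begin

section \<open>Operators on formal power series over an abelian group\<close>

text \<open>Multiplication by \<open>t\<close>; \<open>fps_X * X\<close> is not available, since the coefficients form only a
  group.\<close>

definition fps_up :: "'l::ab_group_add fps \<Rightarrow> 'l fps" where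
  "fps_up X = Abs_fps (\<lambda>n. if n = 0 then 0 else fps_nth X (n - 1))"

lemma fps_up_nth [simp]:
  "fps_nth (fps_up X) 0 = 0" "fps_nth (fps_up X) (Suc n) = fps_nth X n"
  by (simp_all add: fps_up_def)

lemma fps_up_power_nth:
  "fps_nth ((fps_up ^^ n) X) m = (if m < n then 0 else fps_nth X (m - n))"
proof (induction n arbitrary: m)
  case (Suc n)
  then show ?case by (cases m) auto
qed simp

lemma fps_up_power_inj: "(fps_up ^^ n) X = (fps_up ^^ n) Y \<longleftrightarrow> X = Y"
proof
  assume eq: "(fps_up ^^ n) X = (fps_up ^^ n) Y"
  show "X = Y"
  proof (rule fps_ext)
    fix m
    have "fps_nth ((fps_up ^^ n) X) (n + m) = fps_nth ((fps_up ^^ n) Y) (n + m)"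
      using eq by simp
    then show "fps_nth X m = fps_nth Y m"
      by (simp add: fps_up_power_nth)
  qed
qed simp

text \<open>Splitting off the constant term reduces coefficient \<open>n\<close> of a series to
  coefficient \<open>n - 1\<close> of its shift, which drives the inductions on
  coefficients.\<close>

lemma fps_decompose: "X = fps_const (fps_nth X 0) + fps_up (fps_shift 1 X)"
proof (rule fps_ext)
  fix n show "fps_nth X n = fps_nth (fps_const (fps_nth X 0) + fps_up (fps_shift 1 X)) n"
    by (cases n) auto
qed

text \<open>Turns agreement modulo \<open>t^n\<close> into an exact equation with an explicit
  remainder, which can then be substituted into other identities.\<close>

lemma fps_up_power_diff:
  assumes "\<And>m. m < n \<Longrightarrow> fps_nth X m = fps_nth Y m"
  shows "X = Y + (fps_up ^^ n) (fps_shift n (X - Y))"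
  using assms by (intro fps_ext) (simp add: fps_up_power_nth)

section \<open>Linearity over Z[t]\<close>

definition t_linear :: "('l::ab_group_add fps \<Rightarrow> 'm::ab_group_add fps) \<Rightarrow> bool" where
  "t_linear T \<longleftrightarrow> (\<forall>X Y. T (X + Y) = T X + T Y) \<and> (\<forall>X. T (fps_up X) = fps_up (T X))"

lemma t_linearD:
  assumes "t_linear T"
  shows "T (X + Y) = T X + T Y" "T (fps_up X) = fps_up (T X)"
    "T ((fps_up ^^ n) X) = (fps_up ^^ n) (T X)"
proof -
  show "T (X + Y) = T X + T Y" and up: "T (fps_up X) = fps_up (T X)" for X
    using assms by (auto simp: t_linear_def)
  show "T ((fps_up ^^ n) X) = (fps_up ^^ n) (T X)"
    by (induction n) (simp_all add: up)
qed

text \<open>After the constant term is removed, a multiple of \<open>t\<close> remains, and both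
  operators let \<open>t\<close> pass. Coefficient \<open>n\<close> thus reduces to coefficient
  \<open>n - 1\<close> at the shifted series, so the induction needs \<open>X\<close>
  arbitrary.\<close>

lemma t_linear_eqI:
  assumes S: "t_linear S" and T: "t_linear T"
    and const: "\<And>a. S (fps_const a) = T (fps_const a)"
  shows "S X = T X"
proof (rule fps_ext)
  fix n
  have split: "F X = F (fps_const (fps_nth X 0)) + fps_up (F (fps_shift 1 X))"
    if "t_linear F" for F :: "'a fps \<Rightarrow> 'b fps" and X
    by (subst fps_decompose) (simp only: t_linearD[OF that])
  show "fps_nth (S X) n = fps_nth (T X) n"
  proof (induction n arbitrary: X)
    case 0
    show ?case
      by (subst split[OF S], subst split[OF T]) (simp add: const)
  next
    case (Suc n)
    show ?case
      by (subst split[OF S], subst split[OF T]) (simp add: const Suc)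
  qed
qed

lemma fps_up_add: "fps_up (X + Y) = fps_up X + fps_up Y"
  by (rule fps_ext) (simp add: fps_up_def)

lemma fps_up_power_add: "(fps_up ^^ n) (X + Y) = (fps_up ^^ n) X + (fps_up ^^ n) Y"
  by (rule fps_ext) (simp add: fps_up_power_nth)

lemma t_linear_ident: "t_linear (\<lambda>X. X)"
  by (simp add: t_linear_def)

lemma t_linear_zero: "t_linear (\<lambda>X. 0)"
  by (auto simp: t_linear_def fps_up_def intro!: fps_ext)

lemma t_linear_add: "t_linear S \<Longrightarrow> t_linear T \<Longrightarrow> t_linear (\<lambda>X. S X + T X)"
  by (simp add: t_linear_def fps_up_add)

lemma t_linear_uminus: "t_linear S \<Longrightarrow> t_linear (\<lambda>X. - S X)"
  by (auto simp: t_linear_def fps_up_def intro!: fps_ext)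

lemma t_linear_compose: "t_linear S \<Longrightarrow> t_linear T \<Longrightarrow> t_linear (\<lambda>X. S (T X))"
  by (simp add: t_linear_def)

section \<open>Series of maps as operators on \<open>L[[t]]\<close>\<close>

lemma t_linear_ext_linear:
  assumes "\<And>i. additive (F i)"
  shows "t_linear (ext_linear F)"
  unfolding t_linear_def
proof (intro conjI allI)
  note add = additive.add[OF assms] and zero = additive.zero[OF assms]
  fix X Y :: "'a fps"
  show "ext_linear F (X + Y) = ext_linear F X + ext_linear F Y"
    by (rule fps_ext) (simp add: ext_linear_def add sum.distrib)
  show "ext_linear F (fps_up X) = fps_up (ext_linear F X)"
  proof (rule fps_ext)
    fix n show "fps_nth (ext_linear F (fps_up X)) n = fps_nth (fps_up (ext_linear F X)) n"
      by (cases n) (simp_all add: ext_linear_def zero Suc_diff_le)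
  qed
qed

text \<open>Reversing the inner summation exchanges the two arguments, so that facts about the right
  argument carry over to the left one.\<close>

lemma ext_bilinear_flip: "ext_bilinear G X Y = ext_bilinear (\<lambda>i x y. G i y x) Y X"
proof -
  have "(\<Sum>j\<le>n. G i (fps_nth X j) (fps_nth Y (n - j))) =
      (\<Sum>j\<le>n. G i (fps_nth X (n - j)) (fps_nth Y j))" for i n
    by (rule sum.reindex_bij_witness[of _ "\<lambda>j. n - j" "\<lambda>j. n - j"]) auto
  then show ?thesis
    by (simp only: ext_bilinear_def)
qed

lemma t_linear_ext_bilinear_right:
  assumes "\<And>i x. additive (G i x)"
  shows "t_linear (ext_bilinear G X)"
  unfolding t_linear_def
proof (intro conjI allI)
  note add = additive.add[OF assms] and zero = additive.zero[OF assms]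
  fix Y Z :: "'a fps"
  show "ext_bilinear G X (Y + Z) = ext_bilinear G X Y + ext_bilinear G X Z"
    by (rule fps_ext) (simp add: ext_bilinear_def add sum.distrib)
  show "ext_bilinear G X (fps_up Y) = fps_up (ext_bilinear G X Y)"
  proof (rule fps_ext)
    fix n
    show "fps_nth (ext_bilinear G X (fps_up Y)) n = fps_nth (fps_up (ext_bilinear G X Y)) n"
      by (cases n) (simp_all add: ext_bilinear_def zero Suc_diff_le)
  qed
qed

lemma t_linear_ext_bilinear_left:
  assumes "\<And>i y. additive (\<lambda>x. G i x y)"
  shows "t_linear (\<lambda>X. ext_bilinear G X Y)"
  by (subst ext_bilinear_flip, rule t_linear_ext_bilinear_right) (rule assms)

lemma ext_linear_nth_0 [simp]: "fps_nth (ext_linear F X) 0 = F 0 (fps_nth X 0)"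
  by (simp add: ext_linear_def)

lemma ext_bilinear_nth_0 [simp]:
  "fps_nth (ext_bilinear G X Y) 0 = G 0 (fps_nth X 0) (fps_nth Y 0)"
  by (simp add: ext_bilinear_def)

lemma ext_linear_const_nth:
  assumes "\<And>i. additive (F i)"
  shows "fps_nth (ext_linear F (fps_const a)) n = F n a"
proof -
  have "fps_nth (ext_linear F (fps_const a)) n = (\<Sum>i\<le>n. if i = n then F i a else 0)"
    unfolding ext_linear_def fps_nth_Abs_fps
    by (rule sum.cong) (auto simp: additive.zero[OF assms])
  then show ?thesis by simp
qed

lemma ext_bilinear_const_nth:
  assumes "\<And>i x. additive (G i x)" "\<And>i y. additive (\<lambda>x. G i x y)"
  shows "fps_nth (ext_bilinear G (fps_const a) (fps_const b)) n = G n a b"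
proof -
  have "(\<Sum>j\<le>n - i. G i (fps_nth (fps_const a) j) (fps_nth (fps_const b) (n - i - j))) =
     (if i = n then G i a b else 0)" if "i \<le> n" for i
  proof -
    have "(\<Sum>j\<le>n - i. G i (fps_nth (fps_const a) j) (fps_nth (fps_const b) (n - i - j)))
      = (\<Sum>j\<le>n - i. if j = 0 then G i a (fps_nth (fps_const b) (n - i)) else 0)"
      by (rule sum.cong) (auto simp: additive.zero[OF assms(2)])
    also have "\<dots> = (if i = n then G i a b else 0)"
      using that by (auto simp: additive.zero[OF assms(1)])
    finally show ?thesis .
  qed
  then have "fps_nth (ext_bilinear G (fps_const a) (fps_const b)) n =
      (\<Sum>i\<le>n. if i = n then G i a b else 0)"
    unfolding ext_bilinear_def by (auto intro!: sum.cong)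
  then show ?thesis by simp
qed

lemma ext_linear_cong:
  assumes "\<And>i. i \<le> n \<Longrightarrow> F i = F' i" "\<And>i. i \<le> n \<Longrightarrow> fps_nth X i = fps_nth X' i"
  shows "fps_nth (ext_linear F X) n = fps_nth (ext_linear F' X') n"
  using assms by (simp add: ext_linear_def)

lemma ext_bilinear_cong:
  assumes "\<And>i. i \<le> n \<Longrightarrow> fps_nth X i = fps_nth X' i" "\<And>i. i \<le> n \<Longrightarrow> fps_nth Y i = fps_nth Y' i"
  shows "fps_nth (ext_bilinear G X Y) n = fps_nth (ext_bilinear G X' Y') n"
  using assms by (simp add: ext_bilinear_def)

text \<open>Polarisation: expand \<open>g (x + y) (x + y) = 0\<close>.\<close>

lemma alternating_skew:
  assumes "\<And>x. additive (g x)" "\<And>y. additive (\<lambda>x. g x y)" "\<And>x. g x x = 0"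
  shows "g x y = - g y x"
proof -
  have "0 = g (x + y) (x + y)"
    by (simp only: assms(3))
  also have "\<dots> = g x x + g x y + (g y x + g y y)"
    by (simp only: additive.add[OF assms(1)] additive.add[OF assms(2)] ac_simps)
  finally show ?thesis by (simp add: assms(3) eq_neg_iff_add_eq_0)
qed

text \<open>In characteristic 2 skew-symmetry is not enough; the proof peels off the constant term of \<open>X\<close>.\<close>

lemma ext_bilinear_self:
  assumes "\<And>i x. additive (G i x)" "\<And>i y. additive (\<lambda>x. G i x y)" "\<And>i x. G i x x = 0"
  shows "ext_bilinear G X X = 0"
proof -
  note right = t_linear_ext_bilinear_right[of G, OF assms(1)]
    and left = t_linear_ext_bilinear_left[of G, OF assms(2)]
  have skew: "G i x y = - G i y x" for i x y
    by (rule alternating_skew[of "G i", OF assms])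
  have const_skew: "ext_bilinear G (fps_const a) (fps_const b) =
      - ext_bilinear G (fps_const b) (fps_const a)" for a b
    by (rule fps_ext) (simp add: ext_bilinear_const_nth[of G, OF assms(1,2)], rule skew)
  have skew_ext: "ext_bilinear G (fps_const a) Y = - ext_bilinear G Y (fps_const a)" for a Y
    by (rule t_linear_eqI[OF right t_linear_uminus[OF left] const_skew])
  \<comment> \<open>With \<open>X = a + t Y\<close>, the square of \<open>a\<close> vanishes and the
    cross terms cancel by \<open>skew_ext\<close>; only \<open>t^2\<close> times the square of
    \<open>Y\<close> is left.\<close>
  have step: "ext_bilinear G X X = fps_up (fps_up (ext_bilinear G (fps_shift 1 X) (fps_shift 1 X)))" for X
  proof -
    let ?a = "fps_const (fps_nth X 0)" and ?Y = "fps_shift 1 X"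
    have "ext_bilinear G X X = ext_bilinear G (?a + fps_up ?Y) (?a + fps_up ?Y)"
      by (simp only: fps_decompose[symmetric])
    also have "\<dots> = ext_bilinear G ?a ?a + fps_up (ext_bilinear G ?a ?Y) +
        (fps_up (ext_bilinear G ?Y ?a) + fps_up (fps_up (ext_bilinear G ?Y ?Y)))"
      by (simp only: t_linearD[OF left] t_linearD[OF right] fps_up_add ac_simps)
    also have "ext_bilinear G ?a ?a = 0"
      by (rule fps_ext) (simp add: ext_bilinear_const_nth[of G, OF assms(1,2)] assms(3))
    also have "fps_up (ext_bilinear G ?a ?Y) = - fps_up (ext_bilinear G ?Y ?a)"
      by (subst skew_ext) (auto simp: fps_up_def intro: fps_ext)
    finally show ?thesis by simp
  qed
  have "fps_nth (ext_bilinear G X X) n = 0" for n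
  proof (induction n arbitrary: X rule: less_induct)
    case (less n)
    show ?case
    proof (cases n)
      case 0
      then show ?thesis by (simp add: assms(3))
    next
      case (Suc m)
      \<comment> \<open>The factor \<open>t^2\<close> kills coefficient 1 outright and sends every
        later coefficient \<open>n\<close> to coefficient \<open>n - 2\<close> of the shifted
        series.\<close>
      then show ?thesis using less by (subst step) (cases m, auto)
    qed
  qed
  then show ?thesis by (intro fps_ext) simp
qed

section \<open>Low-degree cochains\<close>

definition cochain1 :: "('l::ab_group_add \<Rightarrow> 'l) \<Rightarrow> 'l list \<Rightarrow> 'l" where
  "cochain1 g xs = (if length xs = 1 then g (xs ! 0) else 0)"

definition cochain2 :: "('l::ab_group_add \<Rightarrow> 'l \<Rightarrow> 'l) \<Rightarrow> 'l list \<Rightarrow> 'l" where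
  "cochain2 f xs = (if length xs = 2 then f (xs ! 0) (xs ! 1) else 0)"

lemma cochain1_simp [simp]: "cochain1 g [x] = g x"
  by (simp add: cochain1_def)

lemma cochain2_simp [simp]: "cochain2 f [x, y] = f x y"
  by (simp add: cochain2_def)

lemma cochain1_in_alt_cochains:
  assumes "Vector_Spaces.linear scale scale g"
  shows "cochain1 g \<in> alt_cochains scale 1"
  using assms by (auto simp: alt_cochains_def cochain1_def)

lemma cochain2_in_alt_cochains:
  assumes "alternating_bilinear scale f"
  shows "cochain2 f \<in> alt_cochains scale 2"
proof -
  have "Vector_Spaces.linear scale scale (\<lambda>x. cochain2 f (xs[i := x]))"
    if "length xs = 2" "i < 2" for xs i
  proof -
    have "i = 0 \<or> i = 1" using that by auto
    then show ?thesis
      using assms that by (auto simp: alternating_bilinear_def cochain2_def)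
  qed
  moreover have "cochain2 f xs = 0"
    if "length xs = 2" "i < j" "j < 2" "xs ! i = xs ! j" for xs i j
  proof -
    have "i = 0" "j = 1" using that by auto
    with that have "xs ! 0 = xs ! 1" by simp
    then show ?thesis
      using assms by (simp add: alternating_bilinear_def cochain2_def)
  qed
  ultimately show ?thesis
    by (auto simp: alt_cochains_def) (simp add: cochain2_def)
qed

lemma length_2_exhaust: "length xs = 2 \<Longrightarrow> \<exists>x y. xs = [x, y]"
  by (auto simp: length_Suc_conv numeral_2_eq_2)

lemma length_3_exhaust: "length xs = 3 \<Longrightarrow> \<exists>x y z. xs = [x, y, z]"
  by (auto simp: length_Suc_conv numeral_3_eq_3)

section \<open>The Chevalley-Eilenberg differential in degrees 1 and 2\<close>

context vector_space
begin

text \<open>When both \<open>br\<close> and \<open>rho\<close> are the Lie bracket, this measures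
  the failure of \<open>f\<close> to be a derivation.\<close>

lemma ce_differential_1:
  "ce_differential scale br rho 1 f [x, y] = rho x (f [y]) - rho y (f [x]) - f [br x y]"
proof -
  have "{(i, j). i < j \<and> j < Suc (Suc 0)} = {(0::nat, 1::nat)}"
    by auto
  then show ?thesis
    by (simp add: ce_differential_def nths_Cons)
qed

text \<open>In this degree the sign convention produces the negative of the usual formula.\<close>

lemma ce_differential_2:
  "ce_differential scale br rho 2 f [x, y, z] =
     - rho x (f [y, z]) + rho y (f [x, z]) - rho z (f [x, y])
     + f [br x y, z] - f [br x z, y] + f [br y z, x]"
proof -
  have "{(i, j). i < j \<and> j < (3::nat)} = {(0, 1), (0, 2), (1, 2)}"
    by auto
  then show ?thesis
    by (simp add: ce_differential_def nths_Cons numeral_3_eq_3 numeral_2_eq_2 eval_nat_numeral)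
qed

end


section \<open>Degree 2 cocycles\<close>

lemma linear_additive: "Vector_Spaces.linear s1 s2 f \<Longrightarrow> additive f"
  by (simp add: Vector_Spaces.linear_iff additive_def)

lemma alternating_bilinear_additive:
  assumes "alternating_bilinear scale g"
  shows "additive (g x)" "additive (\<lambda>x. g x y)" "g x x = 0"
  using assms unfolding alternating_bilinear_def by (blast intro: linear_additive)+

lemma alternating_bilinear_skew: "alternating_bilinear scale g \<Longrightarrow> g x y = - g y x"
  by (rule alternating_skew[of g]) (rule alternating_bilinear_additive; assumption)+

context rb_lieder_pair
begin

lemmas bracket_additive = alternating_bilinear_additive(1,2)[OF alternating_bilinear_bracket]
  and bracket_skew = alternating_bilinear_skew[OF alternating_bilinear_bracket]

lemma \<delta>_additive: "additive \<delta>" and R_additive: "additive R"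
  using linear_\<delta> linear_R by (simp_all add: linear_additive)

lemma partial_\<delta>_1: "partial_\<delta> 1 f [x] = f [\<delta> x] - \<delta> (f [x])"
  by (simp add: partial_\<delta>_def)

lemma partial_\<delta>_2: "partial_\<delta> 2 f [x, y] = f [\<delta> x, y] + f [x, \<delta> y] - \<delta> (f [x, y])"
  by (simp add: partial_\<delta>_def numeral_2_eq_2)

lemma Phi_1: "Phi 1 f [x] = f [R x] - R (f [x])"
proof -
  have "{I. I \<subseteq> {..<Suc 0} \<and> card I = 0} = {{}}"
    by (auto simp: card_eq_0_iff dest: finite_subset)
  then show ?thesis by (simp add: Phi_def)
qed

text \<open>The empty set of positions carries the weight \<open>lam\<close>, the two singletons
  carry weight 1. For \<open>f\<close> the bracket itself, vanishing of this expression is the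
  Rota-Baxter identity.\<close>

lemma Phi_2:
  "Phi 2 f [x, y] = f [R x, R y] - (lam *s R (f [x, y]) + (R (f [R x, y]) + R (f [x, R y])))"
proof -
  have "{I. I \<subseteq> {..<2} \<and> card I = 0} = {{} :: nat set}"
    by (auto simp: card_eq_0_iff dest: finite_subset)
  moreover have "{I. I \<subseteq> {..<2} \<and> card I = Suc 0} = {{0}, {1} :: nat set}"
    by (auto simp: card_1_singleton_iff)
  moreover have "{0} \<noteq> {1 :: nat}" by simp
  moreover have "[0..<2] = [0, 1 :: nat]" by (simp add: upt_rec)
  moreover have "{..<2} = {0, 1 :: nat}" by auto
  ultimately show ?thesis by (simp add: Phi_def)
qed

section \<open>From vanishing cohomology to a primitive of a 2-cocycle\<close>

text \<open>The coset of \<open>c\<close> belongs to the quotient, hence is its only element, the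
  set of coboundaries; and \<open>c\<close> lies in its own coset because 0 is a coboundary.\<close>

lemma cocycle_coboundary:
  assumes "trivial_group (rbld_cohomology n)" "c \<in> rbld_cocycles n" "0 \<in> rbld_coboundaries n"
  shows "c \<in> rbld_coboundaries n"
proof -
  let ?G = "\<lparr>carrier = rbld_cocycles n, mult = (+), one = 0\<rparr> :: 'l rbld_cochain monoid"
  have "rbld_coboundaries n #>\<^bsub>?G\<^esub> c \<in> carrier (rbld_cohomology n)"
    using assms(2) by (auto simp: rbld_cohomology_def FactGroup_def RCOSETS_def)
  then have "rbld_coboundaries n #>\<^bsub>?G\<^esub> c = rbld_coboundaries n"
    using assms(1) by (auto simp: trivial_group_def rbld_cohomology_def FactGroup_def)
  moreover have "c \<in> rbld_coboundaries n #>\<^bsub>?G\<^esub> c"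
    using assms(3) by (force simp: r_coset_def)
  ultimately show ?thesis by simp
qed

lemma zero_in_rbld_coboundaries_2: "0 \<in> rbld_coboundaries 2"
proof -
  have zero: "Vector_Spaces.linear scale scale (\<lambda>x. 0)"
    using vector_space_axioms by (simp add: Vector_Spaces.linear_iff)
  have "((0, 0), 0) \<in> rbld_cochains 1"
    using zero by (auto simp: rbld_cochains_def alt_cochains_def)
  moreover have "rbld_differential 1 ((0, 0), 0) = 0"
    by (auto simp: d_def ce_differential_def partial_\<delta>_def Phi_def zero_prod_def fun_eq_iff
        additive.zero[OF bracket_additive(1)] additive.zero[OF \<delta>_additive]
        additive.zero[OF R_additive])
  ultimately show ?thesis
    unfolding rbld_coboundaries_def by force
qed

text \<open>The hypotheses \<open>jac\<close>, \<open>der\<close> and \<open>rb\<close> are the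
  first-order parts of the Jacobi, derivation and Rota-Baxter identities for
  \<open>bracket + t A\<close>, \<open>\<delta> + t B\<close>, \<open>R + t C\<close>. Together they
  say that \<open>(A, B, C)\<close> is a 2-cocycle, and \<open>p\<close> is a 1-cochain with that
  coboundary.\<close>

lemma trivial_cohomology_2:
  assumes trivial: "trivial_group (rbld_cohomology 2)"
    and A: "alternating_bilinear scale A"
    and B: "Vector_Spaces.linear scale scale B"
    and C: "Vector_Spaces.linear scale scale C"
    and jac: "\<And>x y z. A x (bracket y z) + bracket x (A y z) + A y (bracket z x) + bracket y (A z x)
      + A z (bracket x y) + bracket z (A x y) = 0"
    and der: "\<And>x y. B (bracket x y) + \<delta> (A x y) =
      A (\<delta> x) y + bracket (B x) y + A x (\<delta> y) + bracket x (B y)"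
    and rb: "\<And>x y. A (R x) (R y) + bracket (C x) (R y) + bracket (R x) (C y) =
      C (bracket_R x y) + R (A (R x) y + A x (R y) + lam *s A x y + bracket (C x) y + bracket x (C y))"
  obtains p where "Vector_Spaces.linear scale scale p"
    "\<And>x y. A x y = bracket x (p y) + bracket (p x) y - p (bracket x y)"
    "\<And>x. B x = \<delta> (p x) - p (\<delta> x)"
    "\<And>x. C x = R (p x) - p (R x)"
proof -
  note A_add = alternating_bilinear_additive(1)[OF A] and A_skew = alternating_bilinear_skew[OF A]
  have d2: "d 2 (cochain2 A) = 0"
  proof
    fix xs show "d 2 (cochain2 A) xs = 0 xs"
    proof (cases "length xs = 3")
      case True
      then obtain x y z where xs: "xs = [x, y, z]" using length_3_exhaust by blast
      \<comment> \<open>Skew-symmetry of \<open>A\<close> and of the bracket brings the six terms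
        into cyclic order; the result is the negative of the left side of
        \<open>jac\<close>.\<close>
      have "d 2 (cochain2 A) xs = - (A x (bracket y z) + bracket x (A y z) + A y (bracket z x)
          + bracket y (A z x) + A z (bracket x y) + bracket z (A x y))"
        unfolding xs d_def ce_differential_2 cochain2_simp
        using A_skew[of x z] A_skew[of "bracket x y" z] A_skew[of "bracket x z" y]
          A_skew[of "bracket y z" x] bracket_skew[of x z]
        by (simp add: additive.minus[OF A_add] additive.minus[OF bracket_additive(1)])
      then show ?thesis by (simp add: jac)
    next
      case False
      then show ?thesis by (simp add: d_def ce_differential_def)
    qed
  qed
  \<comment> \<open>On \<open>[x, y]\<close> this is the right side of \<open>der\<close> minus its
    left side.\<close>
  have d1: "d 1 (cochain1 B) + (\<lambda>xs. (-1) ^ 2 *s partial_\<delta> 2 (cochain2 A) xs) = 0"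
  proof
    fix xs show "(d 1 (cochain1 B) + (\<lambda>xs. (-1) ^ 2 *s partial_\<delta> 2 (cochain2 A) xs)) xs = 0 xs"
    proof (cases "length xs = 2")
      case True
      then obtain x y where xs: "xs = [x, y]" using length_2_exhaust by blast
      show ?thesis
        unfolding xs d_def plus_fun_def ce_differential_1 partial_\<delta>_2
        using der[of x y] bracket_skew[of y "B x"] by (simp add: algebra_simps)
    next
      case False
      then show ?thesis by (simp add: d_def ce_differential_def partial_\<delta>_def)
    qed
  qed
  \<comment> \<open>On \<open>[x, y]\<close> this is the right side of \<open>rb\<close> minus its
    left side: \<open>rho_R\<close> supplies the brackets with \<open>C\<close>, inside and outside
    \<open>R\<close>, and \<open>Phi\<close> supplies the terms in \<open>A\<close>.\<close>
  have dR: "- d_R 1 (cochain1 C) - Phi 2 (cochain2 A) = 0"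
  proof
    fix xs show "(- d_R 1 (cochain1 C) - Phi 2 (cochain2 A)) xs = 0 xs"
    proof (cases "length xs = 2")
      case True
      then obtain x y where xs: "xs = [x, y]" using length_2_exhaust by blast
      have "R (lam *s A x y) = lam *s R (A x y)"
        using linear_R by (simp add: Vector_Spaces.linear_iff)
      then show ?thesis
        unfolding xs d_R_def fun_diff_def fun_Compl_def ce_differential_1 Phi_2 rho_R_def
        using rb[of x y] bracket_skew[of y "C x"] bracket_skew[of "R y" "C x"]
        by (simp add: algebra_simps additive.add[OF R_additive] additive.minus[OF R_additive])
    next
      case False
      then show ?thesis by (simp add: d_R_def ce_differential_def Phi_def)
    qed
  qed
  let ?c = "((cochain2 A, cochain1 B), cochain1 C)"
  have "?c \<in> rbld_cocycles 2"
    using d2 d1 dR cochain2_in_alt_cochains[OF A] cochain1_in_alt_cochains[OF B]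
      cochain1_in_alt_cochains[OF C]
    by (simp add: rbld_cocycles_def rbld_cochains_def zero_prod_def)
  then have "?c \<in> rbld_coboundaries 2"
    using cocycle_coboundary trivial zero_in_rbld_coboundaries_2 by blast
  then obtain f where f: "f \<in> alt_cochains scale 1"
    and eq: "cochain2 A = d 1 f" "cochain1 B = - partial_\<delta> 1 f" "cochain1 C = - Phi 1 f"
    by (auto simp: rbld_coboundaries_def rbld_cochains_def)
  show ?thesis
  proof (rule that[of "\<lambda>x. f [x]"])
    show "Vector_Spaces.linear scale scale (\<lambda>x. f [x])"
    proof -
      \<comment> \<open>Linearity of a cochain is stated through list updates, so a one-element list
        is needed to start from; its entry 0 is overwritten.\<close>
      have "Vector_Spaces.linear scale scale (\<lambda>x. f ([0][0 := x]))"
        using f unfolding alt_cochains_def mem_Collect_eq by (elim conjE allE[of _ "[0]"] allE[of _ 0]) simp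
      then show ?thesis by simp
    qed
    show "A x y = bracket x (f [y]) + bracket (f [x]) y - f [bracket x y]" for x y
      using fun_cong[OF eq(1), of "[x, y]"] bracket_skew[of y "f [x]"]
      by (simp add: d_def ce_differential_1[simplified])
    show "B x = \<delta> (f [x]) - f [\<delta> x]" for x
      using fun_cong[OF eq(2), of "[x]"] by (simp add: partial_\<delta>_1[simplified])
    show "C x = R (f [x]) - f [R x]" for x
      using fun_cong[OF eq(3), of "[x]"] by (simp add: Phi_1[simplified])
  qed
qed

end


section \<open>Order-by-order trivialisation\<close>

text \<open>The value at a constant \<open>x\<close> of the operator with coefficients
  \<open>\<phi>\<close>, as \<open>ext_linear_const\<close> confirms for additive
  coefficients.\<close>

definition series_at :: "(nat \<Rightarrow> 'l \<Rightarrow> 'l) \<Rightarrow> 'l \<Rightarrow> 'l::ab_group_add fps" where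
  "series_at \<phi> x = Abs_fps (\<lambda>n. \<phi> n x)"

lemma series_at_nth [simp]: "fps_nth (series_at \<phi> x) n = \<phi> n x"
  by (simp add: series_at_def)

lemma ext_linear_const:
  assumes "\<And>i. additive (\<phi> i)"
  shows "ext_linear \<phi> (fps_const x) = series_at \<phi> x"
  by (rule fps_ext) (simp add: ext_linear_const_nth assms)

lemma additive_const_series: "additive f \<Longrightarrow> additive (const_series f i)"
  by (simp add: const_series_def additive_def)

lemma ext_linear_const_series: "additive f \<Longrightarrow> ext_linear (const_series f) (fps_const x) = fps_const (f x)"
  by (rule fps_ext) (simp add: ext_linear_const_nth additive_const_series, simp add: const_series_def)

locale rb_lieder_deformation = rb_lieder_pair scale bracket lam \<delta> R
  for scale :: "'k::field \<Rightarrow> 'l::ab_group_add \<Rightarrow> 'l" (infixr \<open>*s\<close> 75)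
    and bracket :: "'l \<Rightarrow> 'l \<Rightarrow> 'l" and lam :: 'k and \<delta> R :: "'l \<Rightarrow> 'l" +
  fixes \<gamma>t :: "nat \<Rightarrow> 'l \<Rightarrow> 'l \<Rightarrow> 'l" and \<delta>t Rt :: "nat \<Rightarrow> 'l \<Rightarrow> 'l"
  assumes deformation: "formal_deformation \<gamma>t \<delta>t Rt"
begin

abbreviation "\<gamma> \<equiv> ext_bilinear \<gamma>t"
abbreviation "D \<equiv> ext_linear \<delta>t"
abbreviation "P \<equiv> ext_linear Rt"

lemma zeroth [simp]: "\<gamma>t 0 = bracket" "\<delta>t 0 = \<delta>" "Rt 0 = R"
  and \<gamma>t_alternating: "alternating_bilinear scale (\<gamma>t i)"
  and \<delta>t_linear: "Vector_Spaces.linear scale scale (\<delta>t i)"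
  and Rt_linear: "Vector_Spaces.linear scale scale (Rt i)"
  using deformation by (simp_all add: formal_deformation_def)

lemmas \<gamma>t_additive = alternating_bilinear_additive(1,2)[OF \<gamma>t_alternating]

lemma deformation_const:
  fixes a b c
  defines "x \<equiv> fps_const a" and "y \<equiv> fps_const b" and "z \<equiv> fps_const c"
  shows "\<gamma> x (\<gamma> y z) + \<gamma> y (\<gamma> z x) + \<gamma> z (\<gamma> x y) = 0"
    and "\<gamma> (P x) (P y) = P (\<gamma> (P x) y + \<gamma> x (P y) + fps_scale scale lam (\<gamma> x y))"
    and "D (\<gamma> x y) = \<gamma> (D x) y + \<gamma> x (D y)"
  using deformation unfolding x_def y_def z_def formal_deformation_def Let_def by blast+

section \<open>The deformed identities on all of \<open>L[[t]]\<close>\<close>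

lemma t_linear_\<gamma>: "t_linear (\<gamma> X)" "t_linear (\<lambda>X. \<gamma> X Y)"
  and t_linear_D: "t_linear D" and t_linear_P: "t_linear P"
  by (intro t_linear_ext_bilinear_right t_linear_ext_bilinear_left t_linear_ext_linear
      \<gamma>t_additive linear_additive[OF \<delta>t_linear] linear_additive[OF Rt_linear])+

lemma t_linear_scale: "t_linear (fps_scale scale c)"
  by (auto simp: t_linear_def fps_scale_def fps_up_def scale_right_distrib intro!: fps_ext)

lemmas t_linear_intros =
  t_linear_ident t_linear_zero t_linear_add t_linear_\<gamma>
  t_linear_compose[OF t_linear_\<gamma>(1)] t_linear_compose[OF t_linear_\<gamma>(2)]
  t_linear_compose[OF t_linear_D] t_linear_compose[OF t_linear_P]
  t_linear_compose[OF t_linear_scale]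

text \<open>Constants are replaced by series one argument at a time, the sum being
  \<open>t_linear\<close> in each of them. The derivation and Rota-Baxter identities are extended in
  the same way.\<close>

lemma jacobi_ext: "\<gamma> X (\<gamma> Y Z) + \<gamma> Y (\<gamma> Z X) + \<gamma> Z (\<gamma> X Y) = 0"
proof -
  have 1: "\<gamma> (fps_const a) (\<gamma> (fps_const b) Z) + \<gamma> (fps_const b) (\<gamma> Z (fps_const a))
      + \<gamma> Z (\<gamma> (fps_const a) (fps_const b)) = 0" for a b Z
    by (rule t_linear_eqI[where T = "\<lambda>X. 0" and X = Z])
      ((intro t_linear_intros)+, rule deformation_const(1))
  have 2: "\<gamma> (fps_const a) (\<gamma> Y Z) + \<gamma> Y (\<gamma> Z (fps_const a)) + \<gamma> Z (\<gamma> (fps_const a) Y) = 0"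
    for a Y Z
    by (rule t_linear_eqI[where T = "\<lambda>X. 0" and X = Y]) ((intro t_linear_intros)+, rule 1)
  show ?thesis
    by (rule t_linear_eqI[where T = "\<lambda>X. 0" and X = X]) ((intro t_linear_intros)+, rule 2)
qed

lemma derivation_ext: "D (\<gamma> X Y) = \<gamma> (D X) Y + \<gamma> X (D Y)"
proof -
  have 1: "D (\<gamma> (fps_const a) Y) = \<gamma> (D (fps_const a)) Y + \<gamma> (fps_const a) (D Y)" for a Y
    by (rule t_linear_eqI[where X = Y]) ((intro t_linear_intros)+, rule deformation_const(3))
  show ?thesis
    by (rule t_linear_eqI[where X = X]) ((intro t_linear_intros)+, rule 1)
qed

lemma rota_baxter_ext:
  "\<gamma> (P X) (P Y) = P (\<gamma> (P X) Y + \<gamma> X (P Y) + fps_scale scale lam (\<gamma> X Y))"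
proof -
  have 1: "\<gamma> (P (fps_const a)) (P Y) = P (\<gamma> (P (fps_const a)) Y + \<gamma> (fps_const a) (P Y)
      + fps_scale scale lam (\<gamma> (fps_const a) Y))" for a Y
    by (rule t_linear_eqI[where X = Y]) ((intro t_linear_intros)+, rule deformation_const(2))
  show ?thesis
    by (rule t_linear_eqI[where X = X]) ((intro t_linear_intros)+, rule 1)
qed

lemma \<gamma>_self: "\<gamma> X X = 0"
  by (rule ext_bilinear_self) (rule alternating_bilinear_additive[OF \<gamma>t_alternating])+

lemma \<gamma>_scale:
  "\<gamma> (fps_scale scale c X) Y = fps_scale scale c (\<gamma> X Y)"
  "\<gamma> X (fps_scale scale c Y) = fps_scale scale c (\<gamma> X Y)"
proof -
  have "\<gamma>t i (scale c x) y = scale c (\<gamma>t i x y)" "\<gamma>t i x (scale c y) = scale c (\<gamma>t i x y)" for i x y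
    using \<gamma>t_alternating by (simp_all add: alternating_bilinear_def Vector_Spaces.linear_iff)
  then show "\<gamma> (fps_scale scale c X) Y = fps_scale scale c (\<gamma> X Y)"
    "\<gamma> X (fps_scale scale c Y) = fps_scale scale c (\<gamma> X Y)"
    by (auto intro!: fps_ext simp: ext_bilinear_def fps_scale_def scale_sum_right)
qed

lemma ext_linear_scale:
  assumes "\<And>i. Vector_Spaces.linear scale scale (F i)"
  shows "ext_linear F (fps_scale scale c X) = fps_scale scale c (ext_linear F X)"
  using assms
  by (auto intro!: fps_ext simp: ext_linear_def fps_scale_def scale_sum_right Vector_Spaces.linear_iff)

section \<open>Removing the error of order \<open>n\<close>\<close>

text \<open>Coefficient \<open>n\<close> of the three equivalence conditions on constants. The
  source carries the undeformed structure, so each right side involves \<open>\<phi> n\<close>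
  alone.\<close>

definition intertwines :: "(nat \<Rightarrow> 'l \<Rightarrow> 'l) \<Rightarrow> nat \<Rightarrow> bool" where
  "intertwines \<phi> n \<longleftrightarrow>
    (\<forall>x y. fps_nth (\<gamma> (series_at \<phi> x) (series_at \<phi> y)) n = \<phi> n (bracket x y)) \<and>
    (\<forall>x. fps_nth (D (series_at \<phi> x)) n = \<phi> n (\<delta> x)) \<and>
    (\<forall>x. fps_nth (P (series_at \<phi> x)) n = \<phi> n (R x))"

text \<open>Coefficient \<open>n\<close> sees only \<open>\<phi> 0\<close> to
  \<open>\<phi> n\<close>, so later choices cannot spoil an order already settled.\<close>

lemma intertwines_cong:
  assumes "\<And>i. i \<le> n \<Longrightarrow> \<phi> i = \<psi> i"
  shows "intertwines \<phi> n = intertwines \<psi> n"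
proof -
  have nth: "fps_nth (series_at \<phi> x) i = fps_nth (series_at \<psi> x) i" if "i \<le> n" for i x
    using assms that by simp
  have "fps_nth (\<gamma> (series_at \<phi> x) (series_at \<phi> y)) n = fps_nth (\<gamma> (series_at \<psi> x) (series_at \<psi> y)) n"
    "fps_nth (D (series_at \<phi> x)) n = fps_nth (D (series_at \<psi> x)) n"
    "fps_nth (P (series_at \<phi> x)) n = fps_nth (P (series_at \<psi> x)) n" for x y
    by (rule ext_bilinear_cong ext_linear_cong; simp only: nth)+
  then show ?thesis
    unfolding intertwines_def by (simp add: assms)
qed

lemma intertwines_0: "\<phi> 0 = id \<Longrightarrow> intertwines \<phi> 0"
  by (simp add: intertwines_def)

text \<open>The errors at order \<open>n\<close> form a degree 2 class, the obstruction to
  continuing. Starting from \<open>\<phi> n = 0\<close> makes the error equal to the whole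
  coefficient \<open>n\<close> of the deformed side.\<close>

lemma intertwines_extend:
  assumes trivial: "trivial_group (rbld_cohomology 2)"
    and lin: "\<And>i. Vector_Spaces.linear scale scale (\<phi> i)"
    and \<phi>0: "\<phi> 0 = id" and n: "0 < n" and \<phi>n: "\<phi> n = (\<lambda>x. 0)"
    and less: "\<And>m. m < n \<Longrightarrow> intertwines \<phi> m"
  obtains q where "Vector_Spaces.linear scale scale q" "intertwines (\<phi>(n := q)) n"
proof -
  define \<psi> where "\<psi> = series_at \<phi>"
  have \<psi>_nth [simp]: "fps_nth (\<psi> x) i = \<phi> i x" for x i
    by (simp add: \<psi>_def)
  have \<psi>_add: "\<psi> (x + y) = \<psi> x + \<psi> y" and \<psi>_scale: "\<psi> (c *s x) = fps_scale scale c (\<psi> x)"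
    for x y c
    using lin by (auto intro!: fps_ext simp: fps_scale_def Vector_Spaces.linear_iff)
  let ?u = "fps_up ^^ n"
  \<comment> \<open>The full remainders after division by \<open>t^n\<close> are kept, so that
    substitution yields exact equations; their constant terms are extracted only at the end.\<close>
  define E where "E x y = fps_shift n (\<gamma> (\<psi> x) (\<psi> y) - \<psi> (bracket x y))" for x y
  define G where "G x = fps_shift n (D (\<psi> x) - \<psi> (\<delta> x))" for x
  define H where "H x = fps_shift n (P (\<psi> x) - \<psi> (R x))" for x
  have \<gamma>\<psi>: "\<gamma> (\<psi> x) (\<psi> y) = \<psi> (bracket x y) + ?u (E x y)" for x y
    unfolding E_def using less by (intro fps_up_power_diff) (simp add: intertwines_def \<psi>_def)
  have D\<psi>: "D (\<psi> x) = \<psi> (\<delta> x) + ?u (G x)" for x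
    unfolding G_def using less by (intro fps_up_power_diff) (simp add: intertwines_def \<psi>_def)
  have P\<psi>: "P (\<psi> x) = \<psi> (R x) + ?u (H x)" for x
    unfolding H_def using less by (intro fps_up_power_diff) (simp add: intertwines_def \<psi>_def)
  note tl = t_linearD[OF t_linear_\<gamma>(1)] t_linearD[OF t_linear_\<gamma>(2)]
    t_linearD[OF t_linear_D] t_linearD[OF t_linear_P] t_linearD[OF t_linear_scale]
  \<comment> \<open>Cancels the factor \<open>t^n\<close> and compares constant terms.\<close>
  note up_eq = fps_up_power_inj[of n, THEN iffD1, THEN arg_cong, of _ _ "\<lambda>X. fps_nth X 0"]
  define A where "A x y = fps_nth (E x y) 0" for x y
  define B where "B x = fps_nth (G x) 0" for x
  define C where "C x = fps_nth (H x) 0" for x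
  have A: "A x y = fps_nth (\<gamma> (\<psi> x) (\<psi> y)) n" and B: "B x = fps_nth (D (\<psi> x)) n"
    and C: "C x = fps_nth (P (\<psi> x)) n" for x y
    by (simp_all add: A_def B_def C_def E_def G_def H_def \<phi>n)
  have alt_A: "alternating_bilinear scale A"
    unfolding alternating_bilinear_def Vector_Spaces.linear_iff
    using vector_space_axioms by (simp add: A \<psi>_add \<psi>_scale \<gamma>_scale \<gamma>_self tl) (simp add: fps_scale_def)
  have lin_B: "Vector_Spaces.linear scale scale B"
    unfolding Vector_Spaces.linear_iff using vector_space_axioms
    by (simp add: B \<psi>_add \<psi>_scale ext_linear_scale[OF \<delta>t_linear] tl) (simp add: fps_scale_def)
  have lin_C: "Vector_Spaces.linear scale scale C"
    unfolding Vector_Spaces.linear_iff using vector_space_axioms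
    by (simp add: C \<psi>_add \<psi>_scale ext_linear_scale[OF Rt_linear] tl) (simp add: fps_scale_def)
  have jac: "A x (bracket y z) + bracket x (A y z) + A y (bracket z x) + bracket y (A z x)
      + A z (bracket x y) + bracket z (A x y) = 0" for x y z
  proof -
    have nested: "\<gamma> (\<psi> x) (\<gamma> (\<psi> y) (\<psi> z)) =
        \<psi> (bracket x (bracket y z)) + ?u (E x (bracket y z) + \<gamma> (\<psi> x) (E y z))" for x y z
      by (simp only: \<gamma>\<psi> tl fps_up_power_add ac_simps)
    have "\<psi> (bracket x (bracket y z) + bracket y (bracket z x) + bracket z (bracket x y))
      + ?u (E x (bracket y z) + \<gamma> (\<psi> x) (E y z) + (E y (bracket z x) + \<gamma> (\<psi> y) (E z x))
        + (E z (bracket x y) + \<gamma> (\<psi> z) (E x y))) = 0"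
      using jacobi_ext[of "\<psi> x" "\<psi> y" "\<psi> z"]
      by (simp only: nested \<psi>_add fps_up_power_add ac_simps)
    \<comment> \<open>The Jacobi identity of \<open>L\<close> collapses the argument of
      \<open>\<psi>\<close> to 0, and coefficient \<open>n\<close> of \<open>\<psi> 0\<close>
      vanishes by \<open>\<phi>n\<close>. Only the constant term of the remainder survives.\<close>
    then have "fps_nth (\<psi> 0 + ?u (E x (bracket y z) + \<gamma> (\<psi> x) (E y z)
        + (E y (bracket z x) + \<gamma> (\<psi> y) (E z x)) + (E z (bracket x y) + \<gamma> (\<psi> z) (E x y)))) n = 0"
      by (simp only: jacobi fps_zero_nth)
    then show ?thesis
      by (simp add: fps_up_power_nth A_def \<phi>n \<phi>0 ac_simps)
  qed
  have der: "B (bracket x y) + \<delta> (A x y) =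
      A (\<delta> x) y + bracket (B x) y + A x (\<delta> y) + bracket x (B y)" for x y
  proof -
    have "D (\<gamma> (\<psi> x) (\<psi> y)) = \<psi> (\<delta> (bracket x y)) + ?u (G (bracket x y) + D (E x y))"
      by (simp only: \<gamma>\<psi> D\<psi> tl fps_up_power_add ac_simps)
    moreover have "\<gamma> (D (\<psi> x)) (\<psi> y) + \<gamma> (\<psi> x) (D (\<psi> y)) = \<psi> (\<delta> (bracket x y)) +
        ?u (E (\<delta> x) y + \<gamma> (G x) (\<psi> y) + E x (\<delta> y) + \<gamma> (\<psi> x) (G y))"
      by (simp only: \<gamma>\<psi> D\<psi> tl fps_up_power_add derivation \<psi>_add ac_simps)
    \<comment> \<open>Both sides of the derivation identity contain
      \<open>\<psi> (\<delta> (bracket x y))\<close>, which cancels.\<close>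
    ultimately have "?u (G (bracket x y) + D (E x y)) =
        ?u (E (\<delta> x) y + \<gamma> (G x) (\<psi> y) + E x (\<delta> y) + \<gamma> (\<psi> x) (G y))"
      using derivation_ext[of "\<psi> x" "\<psi> y"] by simp
    from up_eq[OF this] show ?thesis
      by (simp add: A_def B_def \<phi>0)
  qed
  have rb: "A (R x) (R y) + bracket (C x) (R y) + bracket (R x) (C y) =
      C (bracket_R x y) + R (A (R x) y + A x (R y) + lam *s A x y + bracket (C x) y + bracket x (C y))"
    for x y
  proof -
    \<comment> \<open>The two factors are expanded one after the other. Leaving
      \<open>P (\<psi> y)\<close> intact beside \<open>H x\<close> avoids a separate term with
      \<open>t^(2n)\<close>; its constant term is \<open>R y\<close>.\<close>
    have "\<gamma> (P (\<psi> x)) (P (\<psi> y)) = \<gamma> (\<psi> (R x)) (P (\<psi> y)) + ?u (\<gamma> (H x) (P (\<psi> y)))"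
      by (simp only: P\<psi>[of x] tl)
    also have "\<gamma> (\<psi> (R x)) (P (\<psi> y)) = \<psi> (bracket (R x) (R y)) + ?u (E (R x) (R y) + \<gamma> (\<psi> (R x)) (H y))"
      by (simp only: P\<psi>[of y] tl \<gamma>\<psi> fps_up_power_add ac_simps)
    finally have lhs: "\<gamma> (P (\<psi> x)) (P (\<psi> y)) = \<psi> (bracket (R x) (R y)) +
        ?u (E (R x) (R y) + \<gamma> (\<psi> (R x)) (H y) + \<gamma> (H x) (P (\<psi> y)))"
      by (simp only: fps_up_power_add ac_simps)
    let ?Z = "E (R x) y + \<gamma> (H x) (\<psi> y) + E x (R y) + \<gamma> (\<psi> x) (H y) + fps_scale scale lam (E x y)"
    have "\<gamma> (P (\<psi> x)) (\<psi> y) + \<gamma> (\<psi> x) (P (\<psi> y)) + fps_scale scale lam (\<gamma> (\<psi> x) (\<psi> y)) =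
        \<psi> (bracket_R x y) + ?u ?Z"
      by (simp only: bracket_R_def \<gamma>\<psi> P\<psi> tl fps_up_power_add \<psi>_add \<psi>_scale ac_simps)
    then have "P (\<gamma> (P (\<psi> x)) (\<psi> y) + \<gamma> (\<psi> x) (P (\<psi> y)) + fps_scale scale lam (\<gamma> (\<psi> x) (\<psi> y))) =
        \<psi> (R (bracket_R x y)) + ?u (H (bracket_R x y) + P ?Z)"
      by (simp only: P\<psi> tl fps_up_power_add ac_simps)
    \<comment> \<open>By the Rota-Baxter identity of \<open>R\<close>, the summands under
      \<open>\<psi>\<close> agree on both sides and cancel.\<close>
    then have "?u (E (R x) (R y) + \<gamma> (\<psi> (R x)) (H y) + \<gamma> (H x) (P (\<psi> y))) =
        ?u (H (bracket_R x y) + P ?Z)"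
      using lhs rota_baxter_ext[of "\<psi> x" "\<psi> y"] rota_baxter[of x y]
      by (simp add: bracket_R_def)
    from up_eq[OF this] show ?thesis
      by (simp add: A_def C_def \<phi>0 fps_scale_def additive.add[OF R_additive] ac_simps)
  qed
  obtain p where lin_p: "Vector_Spaces.linear scale scale p"
    and p: "\<And>x y. A x y = bracket x (p y) + bracket (p x) y - p (bracket x y)"
    "\<And>x. B x = \<delta> (p x) - p (\<delta> x)" "\<And>x. C x = R (p x) - p (R x)"
    using trivial_cohomology_2[OF trivial alt_A lin_B lin_C jac der rb] by blast
  let ?q = "\<lambda>x. - p x"
  have series_upd: "series_at (\<phi>(n := ?q)) x = \<psi> x + ?u (fps_const (- p x))" for x
    by (rule fps_ext) (simp add: fps_up_power_nth \<phi>n)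
  \<comment> \<open>The correction enters both arguments, but its product with itself has order
    \<open>2n\<close>, which exceeds \<open>n\<close> since \<open>n\<close> is positive. Only the
    two mixed terms contribute.\<close>
  have "fps_nth (\<gamma> (series_at (\<phi>(n := ?q)) x) (series_at (\<phi>(n := ?q)) y)) n =
      A x y + bracket x (- p y) + bracket (- p x) y" for x y
    unfolding series_upd using n
    by (simp add: tl A \<phi>0 fps_up_power_nth)
  moreover have "fps_nth (D (series_at (\<phi>(n := ?q)) x)) n = B x + \<delta> (- p x)"
    "fps_nth (P (series_at (\<phi>(n := ?q)) x)) n = C x + R (- p x)" for x
    unfolding series_upd by (simp_all add: tl B C fps_up_power_nth)
  ultimately have "intertwines (\<phi>(n := ?q)) n"
    by (simp add: intertwines_def p additive.minus[OF bracket_additive(1)]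
        additive.minus[OF bracket_additive(2)] additive.minus[OF \<delta>_additive]
        additive.minus[OF R_additive])
  moreover have "Vector_Spaces.linear scale scale ?q"
    using lin_p by (simp add: Vector_Spaces.linear_iff)
  ultimately show ?thesis using that by blast
qed

section \<open>Assembling the formal isomorphism\<close>

lemma intertwiner_exists:
  assumes "trivial_group (rbld_cohomology 2)"
  obtains \<phi> where "\<And>n. Vector_Spaces.linear scale scale (\<phi> n)" "\<phi> 0 = id"
    "\<And>n. intertwines \<phi> n"
proof -
  \<comment> \<open>Overwriting entry \<open>n\<close> by \<open>q\<close> makes the condition
    depend on \<open>\<phi>\<close> only below \<open>n\<close>, as recursive choice along
    \<open><\<close> requires.\<close>
  let ?P = "\<lambda>\<phi> n q. Vector_Spaces.linear scale scale q \<and> (n = 0 \<longrightarrow> q = id) \<and> intertwines (\<phi>(n := q)) n"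
  have "\<exists>\<phi>. \<forall>n. ?P \<phi> n (\<phi> n)"
  proof (rule dependent_wf_choice[OF wf_less])
    fix \<phi> \<psi> :: "nat \<Rightarrow> 'l \<Rightarrow> 'l" and n q
    assume "\<And>m. (m, n) \<in> {(x, y). x < y} \<Longrightarrow> \<phi> m = \<psi> m"
    then have "intertwines (\<phi>(n := q)) n = intertwines (\<psi>(n := q)) n"
      by (intro intertwines_cong) auto
    then show "?P \<phi> n q = ?P \<psi> n q" by simp
  next
    fix n and \<phi> :: "nat \<Rightarrow> 'l \<Rightarrow> 'l"
    assume "\<And>m. (m, n) \<in> {(x, y). x < y} \<Longrightarrow> ?P \<phi> m (\<phi> m)"
    then have IH: "?P \<phi> m (\<phi> m)" if "m < n" for m
      using that by blast
    show "\<exists>q. ?P \<phi> n q"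
    proof (cases "n = 0")
      case True
      moreover have "Vector_Spaces.linear scale scale id"
        using vector_space_axioms by (simp add: Vector_Spaces.linear_iff)
      ultimately show ?thesis
        using intertwines_0[of "\<phi>(0 := id)"] by auto
    next
      case False
      \<comment> \<open>During the choice nothing is known about \<open>\<phi>\<close> from
        \<open>n\<close> on; truncation by 0 makes all coefficients linear and coefficient
        \<open>n\<close> zero.\<close>
      define \<psi> where "\<psi> m = (if m < n then \<phi> m else (\<lambda>x. 0))" for m
      have "Vector_Spaces.linear scale scale (\<psi> m)" for m
        using IH[of m] vector_space_axioms by (auto simp: \<psi>_def Vector_Spaces.linear_iff)
      moreover have "intertwines \<psi> m" if "m < n" for m
      proof -
        have "intertwines \<psi> m = intertwines \<phi> m"
          using that by (intro intertwines_cong) (simp add: \<psi>_def)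
        then show ?thesis using IH[OF that] by simp
      qed
      moreover have "\<psi> 0 = id" "\<psi> n = (\<lambda>x. 0)"
        using False IH[of 0] by (simp_all add: \<psi>_def)
      ultimately obtain q where "Vector_Spaces.linear scale scale q" "intertwines (\<psi>(n := q)) n"
        using False intertwines_extend[OF assms, of \<psi> n] by blast
      moreover have "intertwines (\<psi>(n := q)) n = intertwines (\<phi>(n := q)) n"
        by (intro intertwines_cong) (simp add: \<psi>_def)
      ultimately show ?thesis using False by blast
    qed
  qed
  then obtain \<phi> where \<phi>: "\<And>n. ?P \<phi> n (\<phi> n)" by blast
  then have "\<And>n. Vector_Spaces.linear scale scale (\<phi> n)" "\<phi> 0 = id" "\<And>n. intertwines \<phi> n"
    by (blast, blast) (metis \<phi> fun_upd_triv)
  then show ?thesis using that by blast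
qed

text \<open>On constants the equations hold coefficient by coefficient through
  \<open>intertwines\<close>; both sides are \<open>t_linear\<close> in each argument, which extends
  them to \<open>L[[t]]\<close>.\<close>

lemma intertwiner_equivalence:
  assumes lin: "\<And>n. Vector_Spaces.linear scale scale (\<phi> n)" and \<phi>: "\<And>n. intertwines \<phi> n"
  defines "F \<equiv> ext_linear \<phi>"
  shows "F (ext_bilinear (const_series bracket) X Y) = \<gamma> (F X) (F Y)"
    and "F (ext_linear (const_series \<delta>) X) = D (F X)"
    and "F (ext_linear (const_series R) X) = P (F X)"
proof -
  note add = linear_additive[OF lin]
  have t_F: "t_linear F"
    unfolding F_def by (rule t_linear_ext_linear[OF add])
  have F_const: "F (fps_const x) = series_at \<phi> x" for x
    unfolding F_def by (rule ext_linear_const[OF add])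
  have br: "additive (const_series bracket i x)" "additive (\<lambda>x. const_series bracket i x y)" for i x y
    using bracket_additive by (simp_all add: const_series_def additive_def)
  note t_br = t_linear_ext_bilinear_right[of "const_series bracket", OF br(1)]
    t_linear_ext_bilinear_left[of "const_series bracket", OF br(2)]
  have br_const: "ext_bilinear (const_series bracket) (fps_const a) (fps_const b) =
      fps_const (bracket a b)" for a b
    by (rule fps_ext) (simp add: ext_bilinear_const_nth br, simp add: const_series_def)
  have "F (ext_bilinear (const_series bracket) (fps_const a) (fps_const b)) =
      \<gamma> (F (fps_const a)) (F (fps_const b))" for a b
    unfolding br_const F_const using \<phi> by (auto intro!: fps_ext simp: intertwines_def)
  then have "F (ext_bilinear (const_series bracket) (fps_const a) Y) = \<gamma> (F (fps_const a)) (F Y)"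
    for a Y
    by (rule t_linear_eqI[OF t_linear_compose[OF t_F t_br(1)] t_linear_compose[OF t_linear_\<gamma>(1) t_F]])
  then show "F (ext_bilinear (const_series bracket) X Y) = \<gamma> (F X) (F Y)"
    by (rule t_linear_eqI[OF t_linear_compose[OF t_F t_br(2)] t_linear_compose[OF t_linear_\<gamma>(2) t_F]])
  show "F (ext_linear (const_series \<delta>) X) = D (F X)"
  proof (rule t_linear_eqI[OF t_linear_compose[OF t_F] t_linear_compose[OF t_linear_D t_F]])
    show "t_linear (ext_linear (const_series \<delta>))"
      by (rule t_linear_ext_linear[OF additive_const_series[OF \<delta>_additive]])
    show "F (ext_linear (const_series \<delta>) (fps_const a)) = D (F (fps_const a))" for a
      using \<phi> by (intro fps_ext)
        (simp add: ext_linear_const_series \<delta>_additive F_const intertwines_def)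
  qed
  show "F (ext_linear (const_series R) X) = P (F X)"
  proof (rule t_linear_eqI[OF t_linear_compose[OF t_F] t_linear_compose[OF t_linear_P t_F]])
    show "t_linear (ext_linear (const_series R))"
      by (rule t_linear_ext_linear[OF additive_const_series[OF R_additive]])
    show "F (ext_linear (const_series R) (fps_const a)) = P (F (fps_const a))" for a
      using \<phi> by (intro fps_ext)
        (simp add: ext_linear_const_series R_additive F_const intertwines_def)
  qed
qed

end

theorem theorem4p2:
  fixes scale :: "'k::field \<Rightarrow> 'l::ab_group_add \<Rightarrow> 'l"
    and bracket :: "'l \<Rightarrow> 'l \<Rightarrow> 'l"
    and lam :: 'k
    and \<delta> R :: "'l \<Rightarrow> 'l"
    and \<gamma>t :: "nat \<Rightarrow> 'l \<Rightarrow> 'l \<Rightarrow> 'l"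
    and \<delta>t Rt :: "nat \<Rightarrow> 'l \<Rightarrow> 'l"
  assumes "rb_lieder_pair scale bracket lam \<delta> R"
    and "trivial_group (rb_lieder_pair.rbld_cohomology scale bracket lam \<delta> R 2)"
    and "rb_lieder_pair.formal_deformation scale bracket lam \<delta> R \<gamma>t \<delta>t Rt"
  shows "equivalent_deformations scale (\<gamma>t, \<delta>t, Rt)
           (const_series bracket, const_series \<delta>, const_series R)"
proof -
  interpret rb_lieder_deformation scale bracket lam \<delta> R \<gamma>t \<delta>t Rt
    using assms(1,3) by (simp add: rb_lieder_deformation_def rb_lieder_deformation_axioms_def)
  obtain \<phi> where "\<And>n. Vector_Spaces.linear scale scale (\<phi> n)" "\<phi> 0 = id" "\<And>n. intertwines \<phi> n"
    using intertwiner_exists[OF assms(2)] by blast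
  then show ?thesis
    unfolding equivalent_deformations_def using intertwiner_equivalence[of \<phi>]
    by (auto simp: fun_eq_iff intro!: exI[of _ \<phi>])
qed

end
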